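(* Let $\alpha\in\mathbb{R}\setminus\{0\}$, $\beta>0$, and put $n=1$ if $\alpha>0$ and $n=2$ if $\alpha<0$. Let $\mathbf{X}=\mathbf{X}_s\mathrm{w}_1+\mathbf{X}_d\mathrm{w}_2\in\mathbb{T}_{\alpha\beta}^{p\times q}$ and let $\mathbf{X}_s=\mathbf{U}_s\boldsymbol\Sigma_s\mathbf{V}_s^{\mathtt{H}_{3-2n}^1}$ and $\mathbf{X}_d=\mathbf{U}_d\boldsymbol\Sigma_d\mathbf{V}_d^{\mathtt{H}_{3-2n}^1}$ be the singular value decompositions of the $(\alpha)$-complex matrices $\mathbf{X}_s$ and $\mathbf{X}_d$ constructed as in the context. Then $\mathbf{X}=\mathbf{U}\boldsymbol\Sigma\mathbf{V}^{\mathtt{H}_{3-2n}^1}$ with $$\mathbf{U}=\frac{\mathbf{U}_s+\mathbf{U}_d}{2}+\frac{\mathbf{U}_s-\mathbf{U}_d}{2\sqrt\beta}\mathrm{j},\quad \boldsymbol\Sigma=\frac{\boldsymbol\Sigma_s+\boldsymbol\Sigma_d}{2}+\frac{\boldsymbol\Sigma_s-\boldsymbol\Sigma_d}{2\sqrt\beta}\mathrm{j},\quad \mathbf{V}=\frac{\mathbf{V}_s+\mathbf{V}_d}{2}+\frac{\mathbf{V}_s-\mathbf{V}_d}{2\sqrt\beta}\mathrm{j}.$$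
   Context: $\mathbb{T}_{\alpha\beta}$ (the $(\alpha\beta)$-tessarines) is the commutative, associative real algebra with basis $1,\mathrm{i},\mathrm{j},\mathrm{k}$ and multiplication $\mathrm{i}^2=\alpha$, $\mathrm{j}^2=\beta$, $\mathrm{k}^2=\alpha\beta$, $\mathrm{i}\mathrm{j}=\mathrm{k}$, $\mathrm{i}\mathrm{k}=\alpha\mathrm{j}$, $\mathrm{j}\mathrm{k}=\beta\mathrm{i}$. $\mathbb{C}_\alpha=\{a+b\mathrm{i}\}$. Put $\mathrm{w}_1=\frac{\sqrt\beta+\mathrm{j}}{2\sqrt\beta}$, $\mathrm{w}_2=\frac{\sqrt\beta-\mathrm{j}}{2\sqrt\beta}$. A matrix $\mathbf{X}=\mathbf{A}+\mathbf{B}\mathrm{i}+\mathbf{C}\mathrm{j}+\mathbf{D}\mathrm{k}$ with real $\mathbf{A},\dots,\mathbf{D}$ is written $\mathbf{X}=\mathbf{X}_s\mathrm{w}_1+\mathbf{X}_d\mathrm{w}_2$ with $\mathbf{X}_s=(\mathbf{A}+\mathbf{B}\mathrm{i})+\sqrt\beta(\mathbf{C}+\mathbf{D}\mathrm{i})$, $\mathbf{X}_d=(\mathbf{A}+\mathbf{B}\mathrm{i})-\sqrt\beta(\mathbf{C}+\mathbf{D}\mathrm{i})$. Hermitian transposes: $\mathbf{X}^{\mathtt{H}_{1}^{1}}=\mathbf{X}^{\mathtt T}$ and $\mathbf{X}^{\mathtt{H}_{-1}^{1}}=\mathbf{A}^{\mathtt T}-\mathbf{B}^{\mathtt T}\mathrm{i}+\mathbf{C}^{\mathtt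 T}\mathrm{j}-\mathbf{D}^{\mathtt T}\mathrm{k}$. SVD of an $(\alpha)$-complex matrix $\mathbf{Z}=\mathbf{M}+\mathbf{N}\mathrm{i}\in\mathbb{C}_\alpha^{p\times q}$ ($\mathbf{M},\mathbf{N}$ real). If $\alpha<0$: let $\dot{\mathbf{U}}\boldsymbol\Sigma\dot{\mathbf{V}}^*$ be an SVD of the complex matrix $\mathbf{M}+\sqrt{|\alpha|}\,\mathbf{N}\epsilon$ ($\epsilon^2=-1$), $\dot{\mathbf{U}}=\mathbf{U}_1+\mathbf{U}_2\epsilon$, $\dot{\mathbf{V}}=\mathbf{V}_1+\mathbf{V}_2\epsilon$; then $\mathbf{Z}=\mathbf{U}\boldsymbol\Sigma\mathbf{V}^{\mathtt{H}_{-1}^1}$ with $\mathbf{U}=\mathbf{U}_1+\frac{\mathbf{U}_2}{\sqrt{|\alpha|}}\mathrm{i}$, $\mathbf{V}=\mathbf{V}_1+\frac{\mathbf{V}_2}{\sqrt{|\alpha|}}\mathrm{i}$. If $\alpha>0$: let $\mathbf{M}+\sqrt\alpha\,\mathbf{N}=\mathbf{U}_1\boldsymbol\Sigma_1\mathbf{V}_1^{\mathtt T}$ and $\mathbf{M}-\sqrt\alpha\,\mathbf{N}=\mathbf{U}_2\boldsymbol\Sigma_2\mathbf{V}_2^{\mathtt T}$ be real SVDs, with the singular values (and the corresponding singular vectors) of each listed in any order; then $\mathbf{Z}=\mathbf{U}\boldsymbol\Sigma\mathbf{V}^{\mathtt{H}_{1}^1}$ with $\mathbf{Y}=\frac{\mathbf{Y}_1+\mathbf{Y}_2}{2}+\frac{\mathbf{Y}_1-\mathbf{Y}_2}{2\sqrt\alpha}\mathrm{i}$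 for $\mathbf{Y}=\mathbf{U},\boldsymbol\Sigma,\mathbf{V}$. *)

theory Defs
  imports Complex_Main "Jordan_Normal_Form.Schur_Decomposition"
begin

(* Tess a b c d is a + b i + c j + d k.  The additive structure does not depend on
   the parameters \<alpha>, \<beta>; the product does, so it is an explicit function of them
   and not an instance of class times. *)
datatype tess = Tess (re: real) (im_i: real) (im_j: real) (im_k: real)

instantiation tess :: real_vector
begin

definition "0 = Tess 0 0 0 0"
definition "x + y = Tess (re x + re y) (im_i x + im_i y) (im_j x + im_j y) (im_k x + im_k y)"
definition "- x = Tess (- re x) (- im_i x) (- im_j x) (- im_k x)"
definition "x - y = Tess (re x - re y) (im_i x - im_i y) (im_j x - im_j y) (im_k x - im_k y)"
definition "r *\<^sub>R x = Tess (r * re x) (r * im_i x) (r * im_j x) (r * im_k x)"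

instance
  by standard
    (auto simp: zero_tess_def plus_tess_def uminus_tess_def minus_tess_def scaleR_tess_def
      algebra_simps)

end

definition tess_one :: tess where "tess_one = Tess 1 0 0 0"
definition tess_i :: tess where "tess_i = Tess 0 1 0 0"
definition tess_j :: tess where "tess_j = Tess 0 0 1 0"
definition tess_k :: tess where "tess_k = Tess 0 0 0 1"

definition tess_mult :: "real \<Rightarrow> real \<Rightarrow> tess \<Rightarrow> tess \<Rightarrow> tess" where
  "tess_mult \<alpha> \<beta> x y = Tess
     (re x * re y + \<alpha> * im_i x * im_i y + \<beta> * im_j x * im_j y + \<alpha> * \<beta> * im_k x * im_k y)
     (re x * im_i y + im_i x * re y + \<beta> * (im_j x * im_k y + im_k x * im_j y))
     (re x * im_j y + im_j x * re y + \<alpha> * (im_i x * im_k y + im_k x * im_i y))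
     (re x * im_k y + im_k x * re y + im_i x * im_j y + im_j x * im_i y)"

lemma tess_mult_table:
  "tess_mult \<alpha> \<beta> tess_i tess_i = \<alpha> *\<^sub>R tess_one"
  "tess_mult \<alpha> \<beta> tess_j tess_j = \<beta> *\<^sub>R tess_one"
  "tess_mult \<alpha> \<beta> tess_k tess_k = (\<alpha> * \<beta>) *\<^sub>R tess_one"
  "tess_mult \<alpha> \<beta> tess_i tess_j = tess_k"
  "tess_mult \<alpha> \<beta> tess_i tess_k = \<alpha> *\<^sub>R tess_j"
  "tess_mult \<alpha> \<beta> tess_j tess_k = \<beta> *\<^sub>R tess_i"
  by (simp_all add: tess_mult_def tess_one_def tess_i_def tess_j_def tess_k_def scaleR_tess_def)

lemma tess_mult_algebra:
  "tess_mult \<alpha> \<beta> x y = tess_mult \<alpha> \<beta> y x"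
  "tess_mult \<alpha> \<beta> (tess_mult \<alpha> \<beta> x y) z = tess_mult \<alpha> \<beta> x (tess_mult \<alpha> \<beta> y z)"
  "tess_mult \<alpha> \<beta> tess_one x = x"
  "tess_mult \<alpha> \<beta> (x + y) z = tess_mult \<alpha> \<beta> x z + tess_mult \<alpha> \<beta> y z"
  "tess_mult \<alpha> \<beta> (r *\<^sub>R x) y = r *\<^sub>R tess_mult \<alpha> \<beta> x y"
  by (simp_all add: tess_mult_def tess_one_def plus_tess_def scaleR_tess_def algebra_simps)

definition tmat_mult :: "real \<Rightarrow> real \<Rightarrow> tess mat \<Rightarrow> tess mat \<Rightarrow> tess mat" where
  "tmat_mult \<alpha> \<beta> A B = mat (dim_row A) (dim_col B)
     (\<lambda>(i, j). \<Sum>k = 0..<dim_row B. tess_mult \<alpha> \<beta> (A $$ (i, k)) (B $$ (k, j)))"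

definition tmat_scalar :: "real \<Rightarrow> real \<Rightarrow> tess mat \<Rightarrow> tess \<Rightarrow> tess mat" where
  "tmat_scalar \<alpha> \<beta> A z = map_mat (\<lambda>x. tess_mult \<alpha> \<beta> x z) A"

(* Only \<nu> = 1 (plain transpose) and \<nu> = -1 are meaningful. *)
definition tmat_herm :: "int \<Rightarrow> tess mat \<Rightarrow> tess mat" where
  "tmat_herm \<nu> X = map_mat
     (\<lambda>x. Tess (re x) (of_int \<nu> * im_i x) (im_j x) (of_int \<nu> * im_k x)) (transpose_mat X)"

(* The matrix M + N i.  The (\<alpha>)-complex matrices are those tessarine matrices that
   have this form; their products do not involve \<beta>. *)
definition acmat :: "real mat \<Rightarrow> real mat \<Rightarrow> tess mat" where
  "acmat M N = mat (dim_row M) (dim_col M) (\<lambda>(r, c). Tess (M $$ (r, c)) (N $$ (r, c)) 0 0)"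

definition tmat_s :: "real \<Rightarrow> tess mat \<Rightarrow> tess mat" where
  "tmat_s \<beta> X = acmat (map_mat re X) (map_mat im_i X)
     + map_mat (scaleR (sqrt \<beta>)) (acmat (map_mat im_j X) (map_mat im_k X))"

definition tmat_d :: "real \<Rightarrow> tess mat \<Rightarrow> tess mat" where
  "tmat_d \<beta> X = acmat (map_mat re X) (map_mat im_i X)
     - map_mat (scaleR (sqrt \<beta>)) (acmat (map_mat im_j X) (map_mat im_k X))"

definition tess_w1 :: "real \<Rightarrow> tess" where
  "tess_w1 \<beta> = (1 / (2 * sqrt \<beta>)) *\<^sub>R (sqrt \<beta> *\<^sub>R tess_one + tess_j)"

definition tess_w2 :: "real \<Rightarrow> tess" where
  "tess_w2 \<beta> = (1 / (2 * sqrt \<beta>)) *\<^sub>R (sqrt \<beta> *\<^sub>R tess_one - tess_j)"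

lemma tmat_decomposition:
  assumes "\<beta> > 0"
  shows "X = tmat_scalar \<alpha> \<beta> (tmat_s \<beta> X) (tess_w1 \<beta>) + tmat_scalar \<alpha> \<beta> (tmat_d \<beta> X) (tess_w2 \<beta>)"
proof (rule eq_matI, goal_cases)
  case (1 i j)
  then show ?case
    using assms
    by (intro tess.expand)
      (simp add: tmat_scalar_def tmat_s_def tmat_d_def acmat_def tess_w1_def tess_w2_def
        tess_mult_def tess_one_def tess_j_def plus_tess_def minus_tess_def scaleR_tess_def
        field_simps)
qed (simp_all add: tmat_scalar_def tmat_s_def tmat_d_def acmat_def)

(* Full singular value decompositions: U and V are square.  The singular values may be
   listed in any order. *)
definition real_svd ::
    "nat \<Rightarrow> nat \<Rightarrow> real mat \<Rightarrow> real mat \<Rightarrow> real mat \<Rightarrow> real mat \<Rightarrow> bool" where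
  "real_svd p q M U S V \<longleftrightarrow>
     U \<in> carrier_mat p p \<and> S \<in> carrier_mat p q \<and> V \<in> carrier_mat q q \<and>
     transpose_mat U * U = 1\<^sub>m p \<and> transpose_mat V * V = 1\<^sub>m q \<and>
     diagonal_mat S \<and> (\<forall>r < min p q. 0 \<le> S $$ (r, r)) \<and>
     M = U * S * transpose_mat V"

definition complex_svd ::
    "nat \<Rightarrow> nat \<Rightarrow> complex mat \<Rightarrow> complex mat \<Rightarrow> real mat \<Rightarrow> complex mat \<Rightarrow> bool" where
  "complex_svd p q M U S V \<longleftrightarrow>
     U \<in> carrier_mat p p \<and> S \<in> carrier_mat p q \<and> V \<in> carrier_mat q q \<and>
     mat_adjoint U * U = 1\<^sub>m p \<and> mat_adjoint V * V = 1\<^sub>m q \<and>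
     diagonal_mat S \<and> (\<forall>r < min p q. 0 \<le> S $$ (r, r)) \<and>
     M = U * map_mat complex_of_real S * mat_adjoint V"

definition acmat_of_complex :: "real \<Rightarrow> complex mat \<Rightarrow> tess mat" where
  "acmat_of_complex \<alpha> Y = acmat (map_mat Re Y) ((1 / sqrt \<bar>\<alpha>\<bar>) \<cdot>\<^sub>m map_mat Im Y)"

definition acmat_of_pair :: "real \<Rightarrow> real mat \<Rightarrow> real mat \<Rightarrow> tess mat" where
  "acmat_of_pair \<alpha> Y1 Y2 = acmat ((1 / 2) \<cdot>\<^sub>m (Y1 + Y2)) ((1 / (2 * sqrt \<alpha>)) \<cdot>\<^sub>m (Y1 - Y2))"

(* (U, S, V) arises from the (\<alpha>)-complex p x q matrix Z by the construction from a
   complex SVD (\<alpha> < 0) or a pair of real SVDs (\<alpha> > 0).  That U S V^H is then equal to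
   Z is not part of the definition. *)
definition alpha_svd ::
    "real \<Rightarrow> nat \<Rightarrow> nat \<Rightarrow> tess mat \<Rightarrow> tess mat \<Rightarrow> tess mat \<Rightarrow> tess mat \<Rightarrow> bool" where
  "alpha_svd \<alpha> p q Z U S V \<longleftrightarrow>
     (\<exists>M N. M \<in> carrier_mat p q \<and> N \<in> carrier_mat p q \<and> Z = acmat M N \<and>
       (if \<alpha> < 0 then
          (\<exists>U' S' V'.
             complex_svd p q
               (map_mat complex_of_real M + (complex_of_real (sqrt \<bar>\<alpha>\<bar>) * \<i>) \<cdot>\<^sub>m map_mat complex_of_real N)
               U' S' V' \<and>
             U = acmat_of_complex \<alpha> U' \<and> S = acmat S' (0\<^sub>m p q) \<and> V = acmat_of_complex \<alpha> V')
        else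
          (\<exists>U1 S1 V1 U2 S2 V2.
             real_svd p q (M + sqrt \<alpha> \<cdot>\<^sub>m N) U1 S1 V1 \<and>
             real_svd p q (M - sqrt \<alpha> \<cdot>\<^sub>m N) U2 S2 V2 \<and>
             U = acmat_of_pair \<alpha> U1 U2 \<and> S = acmat_of_pair \<alpha> S1 S2 \<and> V = acmat_of_pair \<alpha> V1 V2)))"

definition tmat_of_pair :: "real \<Rightarrow> real \<Rightarrow> tess mat \<Rightarrow> tess mat \<Rightarrow> tess mat" where
  "tmat_of_pair \<alpha> \<beta> Ys Yd = map_mat (scaleR (1 / 2)) (Ys + Yd)
     + tmat_scalar \<alpha> \<beta> (map_mat (scaleR (1 / (2 * sqrt \<beta>))) (Ys - Yd)) tess_j"

end

theory Submission
  imports Defs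
begin

text \<open>For complex square roots \<open>a\<close> of \<open>\<alpha>\<close> and \<open>b\<close> of \<open>\<beta>\<close>, substituting \<open>a\<close> for \<open>i\<close> and \<open>b\<close> for \<open>j\<close>
  is a ring homomorphism from the tessarines to the complex numbers, and the four homomorphisms
  obtained in this way are jointly injective. It therefore suffices to check the factorization
  after each substitution. The sign of \<open>b\<close> selects either the component \<open>X\<^sub>s\<close> or \<open>X\<^sub>d\<close>; the sign
  of \<open>a\<close> then selects one of the two real decompositions (\<open>\<alpha> > 0\<close>), or the complex decomposition
  or its conjugate (\<open>\<alpha> < 0\<close>).\<close>

section \<open>Evaluation homomorphisms on the tessarines\<close>

definition tess_eval :: "complex \<Rightarrow> complex \<Rightarrow> tess \<Rightarrow> complex" where
  "tess_eval a b x = of_real (re x) + a * of_real (im_i x) + b * of_real (im_j x)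
     + a * b * of_real (im_k x)"

lemma tess_eval_zero [simp]: "tess_eval a b 0 = 0"
  by (simp add: tess_eval_def zero_tess_def)

lemma tess_eval_add: "tess_eval a b (x + y) = tess_eval a b x + tess_eval a b y"
  by (simp add: tess_eval_def plus_tess_def algebra_simps)

lemma tess_eval_diff: "tess_eval a b (x - y) = tess_eval a b x - tess_eval a b y"
  by (simp add: tess_eval_def minus_tess_def algebra_simps)

lemma tess_eval_scaleR: "tess_eval a b (r *\<^sub>R x) = of_real r * tess_eval a b x"
  by (simp add: tess_eval_def scaleR_tess_def algebra_simps)

lemma tess_eval_sum: "tess_eval a b (sum f A) = (\<Sum>x\<in>A. tess_eval a b (f x))"
  by (induction A rule: infinite_finite_induct) (simp_all add: tess_eval_add)

lemma tess_eval_mult: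
  assumes "a\<^sup>2 = of_real \<alpha>" and "b\<^sup>2 = of_real \<beta>"
  shows "tess_eval a b (tess_mult \<alpha> \<beta> x y) = tess_eval a b x * tess_eval a b y"
  unfolding tess_eval_def tess_mult_def
  \<comment> \<open>Replacing \<alpha> and \<beta> by the squares of \<open>a\<close> and
    \<open>b\<close> leaves a polynomial identity.\<close>
  by (simp add: assms [symmetric]) (simp add: power2_eq_square algebra_simps)

text \<open>Signed sums of the values at the four points (\<plusminus>a, \<plusminus>b) isolate the
  coordinates, multiplied by 4, 4a, 4b and 4ab. Both roots are nonzero, so the factors
  cancel.\<close>

lemma tess_eval_eqI:
  assumes "\<alpha> \<noteq> 0" and "\<beta> \<noteq> 0"
    and eq: "\<And>a b. a\<^sup>2 = of_real \<alpha> \<Longrightarrow> b\<^sup>2 = of_real \<beta> \<Longrightarrow> tess_eval a b x = tess_eval a b y"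
  shows "x = y"
proof -
  \<comment> \<open>The complex root exists for either sign of \<alpha>, so no case distinction is
    made here.\<close>
  define a where "a = csqrt (of_real \<alpha>)"
  define b where "b = csqrt (of_real \<beta>)"
  define z where "z = x - y"
  have ab: "a \<noteq> 0" "b \<noteq> 0"
    using assms(1,2) by (auto simp: a_def b_def)
  have zero: "tess_eval (s * a) (t * b) z = 0" if "s\<^sup>2 = 1" "t\<^sup>2 = 1" for s t
    using eq [of "s * a" "t * b"] that
    by (simp add: z_def tess_eval_diff power_mult_distrib a_def b_def)
  have pp: "tess_eval a b z = 0" and mp: "tess_eval (- a) b z = 0"
    and pm: "tess_eval a (- b) z = 0" and mm: "tess_eval (- a) (- b) z = 0"
    using zero [of 1 1] zero [of "- 1" 1] zero [of 1 "- 1"] zero [of "- 1" "- 1"] by simp_all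
  have "4 * of_real (re z) = tess_eval a b z + tess_eval (- a) b z + tess_eval a (- b) z
      + tess_eval (- a) (- b) z"
    and "4 * (a * of_real (im_i z)) = tess_eval a b z - tess_eval (- a) b z + tess_eval a (- b) z
      - tess_eval (- a) (- b) z"
    and "4 * (b * of_real (im_j z)) = tess_eval a b z + tess_eval (- a) b z - tess_eval a (- b) z
      - tess_eval (- a) (- b) z"
    and "4 * (a * b * of_real (im_k z)) = tess_eval a b z - tess_eval (- a) b z
      - tess_eval a (- b) z + tess_eval (- a) (- b) z"
    by (simp_all add: tess_eval_def)
  then have "re z = 0" "im_i z = 0" "im_j z = 0" "im_k z = 0"
    using ab by (simp_all add: pp mp pm mm)
  then have "z = 0"
    by (simp add: zero_tess_def tess.expand)
  then show ?thesis
    by (simp add: z_def)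
qed

section \<open>Evaluation of tessarine matrices\<close>

abbreviation tmat_eval :: "complex \<Rightarrow> complex \<Rightarrow> tess mat \<Rightarrow> complex mat" where
  "tmat_eval a b \<equiv> map_mat (tess_eval a b)"

lemma tmat_eval_mult:
  assumes "a\<^sup>2 = of_real \<alpha>" and "b\<^sup>2 = of_real \<beta>" and "dim_col A = dim_row B"
  shows "tmat_eval a b (tmat_mult \<alpha> \<beta> A B) = tmat_eval a b A * tmat_eval a b B"
  using assms(3)
  by (intro eq_matI)
    (simp_all add: tmat_mult_def scalar_prod_def tess_eval_sum tess_eval_mult [OF assms(1,2)])

lemma tmat_eval_eqI:
  assumes "\<alpha> \<noteq> 0" and "\<beta> \<noteq> 0" and "dim_row A = dim_row B" and "dim_col A = dim_col B"
    and eq: "\<And>a b. a\<^sup>2 = of_real \<alpha> \<Longrightarrow> b\<^sup>2 = of_real \<beta> \<Longrightarrow> tmat_eval a b A = tmat_eval a b B"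
  shows "A = B"
proof (rule eq_matI)
  fix i j
  assume ij: "i < dim_row B" "j < dim_col B"
  show "A $$ (i, j) = B $$ (i, j)"
  proof (rule tess_eval_eqI [OF assms(1,2)])
    fix a b :: complex
    assume "a\<^sup>2 = of_real \<alpha>" "b\<^sup>2 = of_real \<beta>"
    then have "tmat_eval a b A $$ (i, j) = tmat_eval a b B $$ (i, j)"
      by (simp add: eq)
    then show "tess_eval a b (A $$ (i, j)) = tess_eval a b (B $$ (i, j))"
      using ij assms(3,4) by simp
  qed
qed (use assms in simp_all)

text \<open>Conjugation moves from the matrix to the evaluation point: for
  \<open>\<nu> = - 1\<close> the matrix is evaluated at the opposite root of \<alpha>.\<close>

lemma tmat_eval_herm:
  "tmat_eval a b (tmat_herm \<nu> A) = transpose_mat (tmat_eval (of_int \<nu> * a) b A)"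
  by (rule eq_matI) (simp_all add: tmat_herm_def tess_eval_def algebra_simps)

section \<open>Evaluation of components and of recombined pairs\<close>

lemma tmat_eval_acmat:
  assumes "M \<in> carrier_mat p q" and "N \<in> carrier_mat p q"
  shows "tmat_eval a b (acmat M N) = map_mat of_real M + a \<cdot>\<^sub>m map_mat of_real N"
  using assms by (intro eq_matI) (auto simp: acmat_def tess_eval_def)

text \<open>The right-hand \<open>b\<close> is arbitrary because \<open>tmat_s \<beta> X\<close> has
  no j or k coordinates.\<close>

lemma tmat_eval_s: "tmat_eval a (of_real (sqrt \<beta>)) X = tmat_eval a b (tmat_s \<beta> X)"
  by (rule eq_matI)
    (simp_all add: tmat_s_def acmat_def tess_eval_def plus_tess_def scaleR_tess_def algebra_simps)

lemma tmat_eval_d: "tmat_eval a (- of_real (sqrt \<beta>)) X = tmat_eval a b (tmat_d \<beta> X)"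
  by (rule eq_matI)
    (simp_all add: tmat_d_def acmat_def tess_eval_def minus_tess_def scaleR_tess_def algebra_simps)

text \<open>The recombined matrix is Ys w1 + Yd w2. The idempotents w1 and w2 take the values 1 and
  0 at the root \<open>sqrt \<beta>\<close>, and 0 and 1 at its negative.\<close>

lemma tmat_eval_of_pair:
  assumes "\<beta> > 0" and "a\<^sup>2 = of_real \<alpha>"
    and "Ys \<in> carrier_mat p q" and "Yd \<in> carrier_mat p q"
  shows "tmat_eval a (of_real (sqrt \<beta>)) (tmat_of_pair \<alpha> \<beta> Ys Yd)
           = tmat_eval a (of_real (sqrt \<beta>)) Ys"
    and "tmat_eval a (- of_real (sqrt \<beta>)) (tmat_of_pair \<alpha> \<beta> Ys Yd)
           = tmat_eval a (- of_real (sqrt \<beta>)) Yd"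
proof -
  have b: "(of_real (sqrt \<beta>))\<^sup>2 = complex_of_real \<beta>" "(- of_real (sqrt \<beta>))\<^sup>2 = complex_of_real \<beta>"
    using assms(1) by (simp_all flip: of_real_power)
  have j: "tess_eval a b tess_j = b" for b
    by (simp add: tess_eval_def tess_j_def)
  show "tmat_eval a (of_real (sqrt \<beta>)) (tmat_of_pair \<alpha> \<beta> Ys Yd)
      = tmat_eval a (of_real (sqrt \<beta>)) Ys"
    using assms by (intro eq_matI) (auto simp: tmat_of_pair_def tmat_scalar_def tess_eval_add
        tess_eval_diff tess_eval_scaleR tess_eval_mult [OF assms(2) b(1)] j field_simps)
  show "tmat_eval a (- of_real (sqrt \<beta>)) (tmat_of_pair \<alpha> \<beta> Ys Yd)
      = tmat_eval a (- of_real (sqrt \<beta>)) Yd"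
    using assms by (intro eq_matI) (auto simp: tmat_of_pair_def tmat_scalar_def tess_eval_add
        tess_eval_diff tess_eval_scaleR tess_eval_mult [OF assms(2) b(2)] j field_simps)
qed

text \<open>The same interpolation as for \<open>tmat_of_pair\<close>, with i and \<alpha> in the
  roles of j and \<beta>.\<close>

lemma tmat_eval_acmat_of_pair:
  assumes "\<alpha> > 0" and "Y1 \<in> carrier_mat p q" and "Y2 \<in> carrier_mat p q"
  shows "tmat_eval (of_real (sqrt \<alpha>)) b (acmat_of_pair \<alpha> Y1 Y2) = map_mat of_real Y1"
    and "tmat_eval (- of_real (sqrt \<alpha>)) b (acmat_of_pair \<alpha> Y1 Y2) = map_mat of_real Y2"
  using assms
  by (auto simp: acmat_of_pair_def acmat_def tess_eval_def field_simps intro!: eq_matI)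

text \<open>The factor \<open>sqrt \<bar>\<alpha>\<bar>\<close> in the evaluation point cancels the
  scaling of the imaginary part.\<close>

lemma tmat_eval_acmat_of_complex:
  assumes "\<alpha> \<noteq> 0"
  shows "tmat_eval (of_real (sqrt \<bar>\<alpha>\<bar>) * \<i>) b (acmat_of_complex \<alpha> Y) = Y"
    and "tmat_eval (- (of_real (sqrt \<bar>\<alpha>\<bar>) * \<i>)) b (acmat_of_complex \<alpha> Y) = map_mat cnj Y"
  using assms
  by (auto simp: acmat_of_complex_def acmat_def tess_eval_def complex_eq_iff intro!: eq_matI)

section \<open>Evaluated decompositions of (\<alpha>)-complex matrices\<close>

lemma square_eq_of_real_iff:
  fixes z w :: complex
  assumes "w\<^sup>2 = of_real r"
  shows "z\<^sup>2 = of_real r \<longleftrightarrow> z = w \<or> z = - w"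
  by (simp add: power2_eq_iff flip: assms)

text \<open>Splits the adjoint into the transpose coming from \<open>tmat_eval_herm\<close> and the
  conjugate coming from \<open>tmat_eval_acmat_of_complex\<close>.\<close>

lemma mat_adjoint_conv_transpose: "mat_adjoint A = transpose_mat (map_mat cnj A)"
  by (rule eq_matI) (simp_all add: mat_adjoint_def mat_of_rows_def)

lemma map_mat_of_real_svd:
  assumes "real_svd p q M U S V"
  shows "map_mat complex_of_real M
    = map_mat of_real U * map_mat of_real S * transpose_mat (map_mat of_real V)"
proof -
  have c: "U \<in> carrier_mat p p" "S \<in> carrier_mat p q" "transpose_mat V \<in> carrier_mat q q"
    and M: "M = U * S * transpose_mat V"
    using assms by (auto simp: real_svd_def)
  show ?thesis
    unfolding M of_real_hom.mat_hom_mult [OF mult_carrier_mat [OF c(1,2)] c(3)]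
      of_real_hom.mat_hom_mult [OF c(1,2)] map_mat_transpose ..
qed

text \<open>Each root \<open>a\<close> of \<alpha> turns the construction into a factorization known
  from its definition, or into the conjugate of one. The value of \<open>b\<close> is free since
  none of the matrices has j or k coordinates.\<close>

lemma tmat_eval_alpha_svd:
  assumes "\<alpha> \<noteq> 0" and svd: "alpha_svd \<alpha> p q Z U S V" and a: "a\<^sup>2 = of_real \<alpha>"
    and \<nu>: "\<nu> = (if \<alpha> > 0 then 1 else - 1)"
  shows "U \<in> carrier_mat p p" "S \<in> carrier_mat p q" "V \<in> carrier_mat q q"
    and "tmat_eval a b Z = tmat_eval a b U * tmat_eval a b S * tmat_eval a b (tmat_herm \<nu> V)"
proof -
  have "U \<in> carrier_mat p p \<and> S \<in> carrier_mat p q \<and> V \<in> carrier_mat q q \<and>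
    tmat_eval a b Z = tmat_eval a b U * tmat_eval a b S * tmat_eval a b (tmat_herm \<nu> V)"
  proof (cases "\<alpha> < 0")
    case True
    define s where "s = of_real (sqrt \<bar>\<alpha>\<bar>) * \<i>"
    obtain M N U' S' V' where MN: "M \<in> carrier_mat p q" "N \<in> carrier_mat p q" and Z: "Z = acmat M N"
      and csvd: "complex_svd p q (map_mat of_real M + s \<cdot>\<^sub>m map_mat of_real N) U' S' V'"
      and USV: "U = acmat_of_complex \<alpha> U'" "S = acmat S' (0\<^sub>m p q)" "V = acmat_of_complex \<alpha> V'"
      using svd True unfolding alpha_svd_def s_def by auto
    have c: "U' \<in> carrier_mat p p" "S' \<in> carrier_mat p q" "V' \<in> carrier_mat q q"
      and eq: "map_mat of_real M + s \<cdot>\<^sub>m map_mat of_real N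
        = U' * map_mat of_real S' * transpose_mat (map_mat cnj V')"
      using csvd by (auto simp: complex_svd_def mat_adjoint_conv_transpose)
    have "s\<^sup>2 = of_real \<alpha>"
      using True by (simp add: s_def power_mult_distrib flip: of_real_power)
    then consider "a = s" | "a = - s"
      using a square_eq_of_real_iff by blast
    then have "tmat_eval a b Z = tmat_eval a b U * tmat_eval a b S * tmat_eval a b (tmat_herm \<nu> V)"
    proof cases
      case 1
      have "tmat_eval a b S = map_mat of_real S'"
        using c by (auto simp: USV tmat_eval_acmat [of _ p q])
      \<comment> \<open>Here \<open>\<nu> = - 1\<close>, so \<open>V\<close> is evaluated at
        \<open>- s\<close>, which gives the conjugate of \<open>V'\<close>; its transpose is the
        adjoint in \<open>eq\<close>.\<close>
      then show ?thesis
        using True eq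
        by (simp add: \<nu> 1 USV Z tmat_eval_herm tmat_eval_acmat [OF MN]
            tmat_eval_acmat_of_complex [OF assms(1), folded s_def])
    next
      case 2
      have S: "tmat_eval a b S = map_mat of_real S'"
        using c by (auto simp: USV tmat_eval_acmat [of _ p q])
      \<comment> \<open>As \<open>M\<close>, \<open>N\<close> and \<open>S'\<close> are real,
        passing from \<open>s\<close> to \<open>- s\<close> conjugates the whole factorization; the
        adjoint of \<open>V'\<close> becomes its plain transpose.\<close>
      have "tmat_eval a b Z = map_mat cnj (map_mat of_real M + s \<cdot>\<^sub>m map_mat of_real N)"
        using MN by (intro eq_matI) (auto simp: 2 Z tmat_eval_acmat [OF MN] s_def)
      also have "\<dots> = map_mat cnj U' * map_mat of_real S' * transpose_mat V'"
        unfolding eq using c by (intro eq_matI) (auto simp: scalar_prod_def)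
      finally show ?thesis
        using True S
        by (simp add: \<nu> 2 USV tmat_eval_herm tmat_eval_acmat_of_complex [OF assms(1), folded s_def])
    qed
    then show ?thesis
      using c by (auto simp: USV acmat_of_complex_def acmat_def)
  next
    case False
    then have pos: "\<alpha> > 0"
      using assms(1) by simp
    obtain M N U1 S1 V1 U2 S2 V2
      where MN: "M \<in> carrier_mat p q" "N \<in> carrier_mat p q" and Z: "Z = acmat M N"
      and svd1: "real_svd p q (M + sqrt \<alpha> \<cdot>\<^sub>m N) U1 S1 V1"
      and svd2: "real_svd p q (M - sqrt \<alpha> \<cdot>\<^sub>m N) U2 S2 V2"
      and USV: "U = acmat_of_pair \<alpha> U1 U2" "S = acmat_of_pair \<alpha> S1 S2" "V = acmat_of_pair \<alpha> V1 V2"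
      using svd False unfolding alpha_svd_def by auto
    have c: "U1 \<in> carrier_mat p p" "S1 \<in> carrier_mat p q" "V1 \<in> carrier_mat q q"
      "U2 \<in> carrier_mat p p" "S2 \<in> carrier_mat p q" "V2 \<in> carrier_mat q q"
      using svd1 svd2 by (simp_all add: real_svd_def)
    \<comment> \<open>With \<open>\<nu> = 1\<close> the transpose keeps the root \<open>a\<close>,
      so all three factors reduce to the same real decomposition. The two lists of singular values
      never meet, whatever their orders.\<close>
    note ev = tmat_eval_acmat_of_pair [OF pos c(1,4)] tmat_eval_acmat_of_pair [OF pos c(2,5)]
      tmat_eval_acmat_of_pair [OF pos c(3,6)]
    have "(complex_of_real (sqrt \<alpha>))\<^sup>2 = of_real \<alpha>"
      using pos by (simp flip: of_real_power)
    then consider "a = of_real (sqrt \<alpha>)" | "a = - of_real (sqrt \<alpha>)"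
      using a square_eq_of_real_iff by blast
    then have "tmat_eval a b Z = tmat_eval a b U * tmat_eval a b S * tmat_eval a b (tmat_herm \<nu> V)"
    proof cases
      case 1
      have "tmat_eval a b Z = map_mat of_real (M + sqrt \<alpha> \<cdot>\<^sub>m N)"
        using MN by (intro eq_matI) (auto simp: 1 Z tmat_eval_acmat [OF MN])
      then show ?thesis
        using pos by (simp add: \<nu> 1 USV tmat_eval_herm ev map_mat_of_real_svd [OF svd1])
    next
      case 2
      have "tmat_eval a b Z = map_mat of_real (M - sqrt \<alpha> \<cdot>\<^sub>m N)"
        using MN by (intro eq_matI) (auto simp: 2 Z tmat_eval_acmat [OF MN])
      then show ?thesis
        using pos by (simp add: \<nu> 2 USV tmat_eval_herm ev map_mat_of_real_svd [OF svd2])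
    qed
    then show ?thesis
      using c by (auto simp: USV acmat_of_pair_def acmat_def)
  qed
  then show "U \<in> carrier_mat p p" "S \<in> carrier_mat p q" "V \<in> carrier_mat q q"
    and "tmat_eval a b Z = tmat_eval a b U * tmat_eval a b S * tmat_eval a b (tmat_herm \<nu> V)"
    by auto
qed

section \<open>Factorization of tessarine matrices\<close>

theorem proposition8:
  fixes \<alpha> \<beta> :: real and n p q :: nat
    and X Us Ss Vs Ud Sd Vd U S V :: "tess mat"
  assumes "\<alpha> \<noteq> 0" and "\<beta> > 0"
    and "n = (if \<alpha> > 0 then 1 else 2)"
    and "X \<in> carrier_mat p q"
    and "alpha_svd \<alpha> p q (tmat_s \<beta> X) Us Ss Vs"
    and "alpha_svd \<alpha> p q (tmat_d \<beta> X) Ud Sd Vd"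
    and "U = tmat_of_pair \<alpha> \<beta> Us Ud"
    and "S = tmat_of_pair \<alpha> \<beta> Ss Sd"
    and "V = tmat_of_pair \<alpha> \<beta> Vs Vd"
  shows "X = tmat_mult \<alpha> \<beta> (tmat_mult \<alpha> \<beta> U S) (tmat_herm (3 - 2 * int n) V)"
proof -
  define \<nu> where "\<nu> = 3 - 2 * int n"
  have \<nu>: "\<nu> = (if \<alpha> > 0 then 1 else - 1)"
    using assms(3) by (simp add: \<nu>_def)
  \<comment> \<open>A witness for the root in \<open>tmat_eval_alpha_svd\<close>, whose dimension
    facts are taken before any \<open>a\<close> is fixed.\<close>
  have a0: "(csqrt (of_real \<alpha>))\<^sup>2 = of_real \<alpha>"
    by simp
  note cs = tmat_eval_alpha_svd(1-3) [OF assms(1,5) a0 \<nu>]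
  note cd = tmat_eval_alpha_svd(1-3) [OF assms(1,6) a0 \<nu>]
  have c: "U \<in> carrier_mat p p" "S \<in> carrier_mat p q" "V \<in> carrier_mat q q"
    \<comment> \<open>Matrix sums and differences take their dimensions from the second operand,
      here the d-component.\<close>
    using cd by (auto simp: assms(7-9) tmat_of_pair_def tmat_scalar_def)
  have "X = tmat_mult \<alpha> \<beta> (tmat_mult \<alpha> \<beta> U S) (tmat_herm \<nu> V)"
  proof (rule tmat_eval_eqI [of \<alpha> \<beta>])
    fix a b :: complex
    assume a: "a\<^sup>2 = of_real \<alpha>" and b: "b\<^sup>2 = of_real \<beta>"
    \<comment> \<open>After \<open>tmat_eval_herm\<close> the matrix \<open>V\<close> is evaluated
      at \<open>of_int \<nu> * a\<close>, which must again be a root of \<alpha> for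
      \<open>tmat_eval_of_pair\<close> to apply.\<close>
    have na: "(of_int \<nu> * a)\<^sup>2 = of_real \<alpha>"
      using a by (simp add: \<nu>)
    have "(complex_of_real (sqrt \<beta>))\<^sup>2 = of_real \<beta>"
      using assms(2) by (simp flip: of_real_power)
    then consider "b = of_real (sqrt \<beta>)" | "b = - of_real (sqrt \<beta>)"
      using b square_eq_of_real_iff by blast
    then have "tmat_eval a b X = tmat_eval a b U * tmat_eval a b S * tmat_eval a b (tmat_herm \<nu> V)"
    proof cases
      case 1
      \<comment> \<open>The free argument of \<open>tmat_eval_s\<close> is set to the same root
        \<open>sqrt \<beta>\<close>, so that both sides end up evaluated at one point.\<close>
      show ?thesis
        unfolding 1 assms(7-9) tmat_eval_herm tmat_eval_of_pair(1) [OF assms(2) a cs(1) cd(1)]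
          tmat_eval_of_pair(1) [OF assms(2) a cs(2) cd(2)]
          tmat_eval_of_pair(1) [OF assms(2) na cs(3) cd(3)]
          tmat_eval_s [of a \<beta> X "of_real (sqrt \<beta>)"]
          tmat_eval_alpha_svd(4) [OF assms(1,5) a \<nu>] ..
    next
      case 2
      show ?thesis
        unfolding 2 assms(7-9) tmat_eval_herm tmat_eval_of_pair(2) [OF assms(2) a cs(1) cd(1)]
          tmat_eval_of_pair(2) [OF assms(2) a cs(2) cd(2)]
          tmat_eval_of_pair(2) [OF assms(2) na cs(3) cd(3)]
          tmat_eval_d [of a \<beta> X "- of_real (sqrt \<beta>)"]
          tmat_eval_alpha_svd(4) [OF assms(1,6) a \<nu>] ..
    qed
    also have "\<dots> = tmat_eval a b (tmat_mult \<alpha> \<beta> (tmat_mult \<alpha> \<beta> U S) (tmat_herm \<nu> V))"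
    proof -
      have "dim_col U = dim_row S" "dim_col (tmat_mult \<alpha> \<beta> U S) = dim_row (tmat_herm \<nu> V)"
        using c by (simp_all add: tmat_mult_def tmat_herm_def)
      then show ?thesis
        by (simp only: tmat_eval_mult [OF a b])
    qed
    finally show "tmat_eval a b X
      = tmat_eval a b (tmat_mult \<alpha> \<beta> (tmat_mult \<alpha> \<beta> U S) (tmat_herm \<nu> V))" .
  qed (use assms(1,2,4) c in \<open>auto simp: tmat_mult_def tmat_herm_def\<close>)
  then show ?thesis
    by (simp add: \<nu>_def)
qed

end
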